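(* Let $H$ be a symmetric $d\times d$ complex Hadamard matrix and let $G$ be a connected graph on $n\ge 2$ vertices. Then every single-particle reduced density matrix of the generalized graph state $|\psi_{G,H}\rangle$ is maximally mixed; that is, for every $a\in V(G)$, the partial trace of $|\psi_{G,H}\rangle\langle\psi_{G,H}|$ over all qudits other than $a$ equals $\frac{1}{d}I_d$.
   Context: A complex Hadamard matrix of size $d$ is a $d\times d$ complex matrix $H=(h_{ij})_{i,j=0}^{d-1}$ with $|h_{ij}|=1$ for all $i,j$ and $H^\dagger H=dI_d$; it is symmetric if $H=H^T$. A qudit has state space $\mathbb{C}^d$ with computational basis $|0\rangle,\dots,|d-1\rangle$. For symmetric $H$, the generalized controlled-$Z$ gate $C^H$ is the diagonal operator on $\mathbb{C}^d\otimes\mathbb{C}^d$ with $C^H|ij\rangle=h_{ij}|ij\rangle$; $C^H_{ab}$ denotes this gate acting on qudits $a,b$ of an $n$-qudit system. For a (finite, simple) undirected graph $G$ with vertex set $V(G)=\{1,\dots,n\}$ and edge set $E(G)$, the generalized graph state in $(\mathbb{C}^d)^{\otimes n}$ is $$|\psi_{G,H}\rangle=\mathcal{U}_{G,H}|0\rangle^{\otimes n},\qquad \mathcal{U}_{G,H}=\frac{1}{d^{n/2}}\Big(\prod_{ab\in E(G)}C^H_{ab}\Big)H^{\otimes n}.$$ *)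

theory Defs
  imports
    "Jordan_Normal_Form.Schur_Decomposition"
    "Graph_Theory.Graph_Theory"
begin

definition complex_hadamard :: "nat \<Rightarrow> complex mat \<Rightarrow> bool" where
  "complex_hadamard d H \<longleftrightarrow>
     H \<in> carrier_mat d d \<and>
     (\<forall>i<d. \<forall>j<d. cmod (H $$ (i, j)) = 1) \<and>
     mat_adjoint H * H = of_nat d \<cdot>\<^sub>m 1\<^sub>m d"

text \<open>
  The space of \<open>n\<close> qudits is identified with \<open>d ^ n\<close>-dimensional coordinate space.  The
  computational basis state with labels \<open>i\<^sub>1, \<dots>, i\<^sub>n\<close> has index
  \<open>\<Sum>k=1..n. i\<^sub>k * d ^ (n - k)\<close> (the Kronecker product order), so the label of qudit
  \<open>k \<in> {1..n}\<close> is a base-\<open>d\<close> digit of the index.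
\<close>

definition label :: "nat \<Rightarrow> nat \<Rightarrow> nat \<Rightarrow> nat \<Rightarrow> nat" where
  "label d n x k = x div d ^ (n - k) mod d"

definition tensor_power :: "nat \<Rightarrow> nat \<Rightarrow> complex mat \<Rightarrow> complex mat" where
  "tensor_power d n A =
     mat (d ^ n) (d ^ n) (\<lambda>(x, y). \<Prod>k=1..n. A $$ (label d n x k, label d n y k))"

text \<open>The two-qudit basis state with labels \<open>i, j\<close> has index \<open>d * i + j\<close>.\<close>

definition controlled_gate :: "nat \<Rightarrow> complex mat \<Rightarrow> complex mat" where
  "controlled_gate d H =
     mat (d * d) (d * d) (\<lambda>(p, q). if p = q then H $$ (p div d, p mod d) else 0)"

text \<open>The two-qudit operator \<open>A\<close> on qudits \<open>a, b\<close>, tensored with the identity on the others.\<close>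

definition on_qudits :: "nat \<Rightarrow> nat \<Rightarrow> nat \<Rightarrow> nat \<Rightarrow> complex mat \<Rightarrow> complex mat" where
  "on_qudits d n a b A =
     mat (d ^ n) (d ^ n) (\<lambda>(x, y).
       if \<forall>k\<in>{1..n} - {a, b}. label d n x k = label d n y k
       then A $$ (d * label d n x a + label d n x b, d * label d n y a + label d n y b)
       else 0)"

text \<open>
  An undirected edge is a pair of opposite arcs of the (symmetric) graph; it is represented
  here by the arc whose tail is smaller.  For symmetric \<open>H\<close> this choice is immaterial.
\<close>

definition edge_set :: "nat pair_pre_digraph \<Rightarrow> (nat \<times> nat) set" where
  "edge_set G = {(a, b) \<in> parcs G. a < b}"

text \<open>
  The order of the factors does not matter, since the gates are diagonal; see
  \<open>edge_gates_eq_diagonal\<close> below.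
\<close>

definition edge_gates :: "nat \<Rightarrow> nat \<Rightarrow> nat pair_pre_digraph \<Rightarrow> complex mat \<Rightarrow> complex mat" where
  "edge_gates d n G H =
     Finite_Set.fold (\<lambda>(a, b) M. on_qudits d n a b (controlled_gate d H) * M)
       (1\<^sub>m (d ^ n)) (edge_set G)"

definition graph_operator :: "nat \<Rightarrow> nat \<Rightarrow> nat pair_pre_digraph \<Rightarrow> complex mat \<Rightarrow> complex mat" where
  "graph_operator d n G H =
     complex_of_real (1 / real d powr (real n / 2)) \<cdot>\<^sub>m
       (edge_gates d n G H * tensor_power d n H)"

definition graph_state :: "nat \<Rightarrow> nat \<Rightarrow> nat pair_pre_digraph \<Rightarrow> complex mat \<Rightarrow> complex vec" where
  "graph_state d n G H = graph_operator d n G H *\<^sub>v unit_vec (d ^ n) 0"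

definition ket_bra :: "complex vec \<Rightarrow> complex mat" where
  "ket_bra v = mat (dim_vec v) (dim_vec v) (\<lambda>(x, y). v $ x * cnj (v $ y))"

text \<open>
  The partial trace over all qudits other than \<open>a\<close>: the pairs \<open>(x, y)\<close> below are those of the
  form \<open>(i r, j r)\<close> with \<open>r\<close> a joint labelling of the other qudits.
\<close>

definition partial_trace_except :: "nat \<Rightarrow> nat \<Rightarrow> nat \<Rightarrow> complex mat \<Rightarrow> complex mat" where
  "partial_trace_except d n a R =
     mat d d (\<lambda>(i, j).
       \<Sum>(x, y) | x < d ^ n \<and> y < d ^ n \<and> label d n x a = i \<and> label d n y a = j \<and>
                 (\<forall>k\<in>{1..n} - {a}. label d n x k = label d n y k).
         R $$ (x, y))"

lemma label_less: "d > 0 \<Longrightarrow> label d n x k < d"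
  by (simp add: label_def)

lemma label_inject:
  assumes "x < d ^ n" "y < d ^ n" "\<And>k. k \<in> {1..n} \<Longrightarrow> label d n x k = label d n y k"
  shows "x = y"
  using assms
proof (induction n arbitrary: x y)
  case 0
  then show ?case by simp
next
  case (Suc n)
  have "x mod d = y mod d"
    using Suc.prems(3)[of "Suc n"] by (simp add: label_def)
  moreover have "x div d = y div d"
  proof (rule Suc.IH)
    show "x div d < d ^ n" "y div d < d ^ n"
      using Suc.prems(1,2) by (simp_all add: less_mult_imp_div_less mult.commute)
    fix k assume k: "k \<in> {1..n}"
    then have "Suc n - k = Suc (n - k)" by auto
    then show "label d n (x div d) k = label d n (y div d) k"
      using Suc.prems(3)[of k] k by (simp add: label_def div_mult2_eq)
  qed
  ultimately show ?case by (metis div_mult_mod_eq)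
qed

lemma on_qudits_controlled_gate:
  assumes "d > 0" "a \<in> {1..n}" "b \<in> {1..n}"
  shows "on_qudits d n a b (controlled_gate d H) =
    mat (d ^ n) (d ^ n) (\<lambda>(x, y). if x = y then H $$ (label d n x a, label d n x b) else 0)"
proof (rule eq_matI, goal_cases)
  case (1 x y)
  then have xy: "x < d ^ n" "y < d ^ n" by simp_all
  let ?p = "\<lambda>x. d * label d n x a + label d n x b"
  have div: "?p z div d = label d n z a" and mod: "?p z mod d = label d n z b" for z
    using label_less[OF assms(1), of n z b] by simp_all
  have lt: "?p z < d * d" for z
  proof -
    have "?p z < d * Suc (label d n z a)"
      using label_less[OF assms(1), of n z b] by simp
    also have "\<dots> \<le> d * d"
      using label_less[OF assms(1), of n z a] by (intro mult_le_mono) auto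
    finally show ?thesis .
  qed
  have "x = y" if "\<forall>k\<in>{1..n} - {a, b}. label d n x k = label d n y k" "?p x = ?p y"
  proof (rule label_inject[OF xy])
    fix k assume "k \<in> {1..n}"
    then show "label d n x k = label d n y k"
      using that(1) div[of x] div[of y] mod[of x] mod[of y] unfolding that(2)
      by (cases "k = a \<or> k = b") auto
  qed
  then show ?case
    using xy by (auto simp: on_qudits_def controlled_gate_def lt div mod label_less[OF assms(1)])
qed (simp_all add: on_qudits_def)

lemma diagonal_mult:
  fixes f g :: "nat \<Rightarrow> complex"
  shows "mat N N (\<lambda>(x, y). if x = y then f x else 0) * mat N N (\<lambda>(x, y). if x = y then g x else 0) =
    mat N N (\<lambda>(x, y). if x = y then f x * g x else 0)"
proof (rule eq_matI, goal_cases)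
  case (1 x y)
  then have xy: "x < N" "y < N" by simp_all
  have "(\<Sum>k = 0..<N. (if x = k then f x else 0) * (if k = y then g k else 0)) =
      (\<Sum>k = 0..<N. if x = k then f x * (if k = y then g k else 0) else 0)"
    by (intro sum.cong) auto
  also have "\<dots> = (if x = y then f x * g x else 0)"
    using xy by (simp add: sum.delta')
  finally show ?case using xy by (simp add: scalar_prod_def)
qed simp_all

lemma edge_gates_eq_diagonal:
  assumes "d > 0" "pair_graph G" "pverts G = {1..n}"
  shows "edge_gates d n G H =
    mat (d ^ n) (d ^ n) (\<lambda>(x, y).
      if x = y then \<Prod>(a, b)\<in>edge_set G. H $$ (label d n x a, label d n x b) else 0)"
proof -
  interpret pair_graph G by fact
  let ?f = "\<lambda>(a, b) M. on_qudits d n a b (controlled_gate d H) * M"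
  let ?D = "\<lambda>S. mat (d ^ n) (d ^ n) (\<lambda>(x, y).
      if x = y then \<Prod>(a, b)\<in>S. H $$ (label d n x a, label d n x b) else (0 :: complex))"
  have sub: "edge_set G \<subseteq> {1..n} \<times> {1..n}"
    using assms(3) in_arcsD1 in_arcsD2 by (auto simp: edge_set_def)
  have fin: "finite (edge_set G)"
    using sub finite_subset by blast
  have diag: "M = ?D S" if "fold_graph ?f (1\<^sub>m (d ^ n)) S M" "S \<subseteq> edge_set G" for S M
    using that
  proof (induction rule: fold_graph.induct)
    case emptyI
    show ?case by (rule eq_matI) auto
  next
    case (insertI e S M)
    obtain a b where e: "e = (a, b)" by (cases e)
    have ab: "a \<in> {1..n}" "b \<in> {1..n}" using insertI.prems sub e by auto
    have finS: "finite S" using insertI.prems fin finite_subset by auto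
    have M: "M = ?D S" using insertI by auto
    have eq: "(\<Prod>(a, b)\<in>insert e S. H $$ (label d n x a, label d n x b)) =
        H $$ (label d n x a, label d n x b) * (\<Prod>(a, b)\<in>S. H $$ (label d n x a, label d n x b))"
      for x
      using insertI.hyps(1) finS by (simp add: e)
    show ?case
      unfolding M eq
      by (simp add: e on_qudits_controlled_gate[OF assms(1) ab] diagonal_mult)
  qed
  obtain M where M: "fold_graph ?f (1\<^sub>m (d ^ n)) (edge_set G) M"
    by (rule exE[OF finite_imp_fold_graph[OF fin]])
  have "fold_graph ?f (1\<^sub>m (d ^ n)) (edge_set G) (?D (edge_set G))"
    using M unfolding diag[OF M subset_refl] .
  then have "(THE M. fold_graph ?f (1\<^sub>m (d ^ n)) (edge_set G) M) = ?D (edge_set G)"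
    by (rule the_equality) (rule diag[OF _ subset_refl])
  then show ?thesis
    unfolding edge_gates_def Finite_Set.fold_def if_P[OF fin] .
qed

end

theory Submission
  imports Defs
begin

text \<open>
  In the \<open>(i, j)\<close> entry of the reduced density matrix at \<open>a\<close>, a joint labelling \<open>r\<close> of the other
  qudits contributes, up to a phase and the factor \<open>1 / d ^ n\<close>, the product over the neighbours \<open>b\<close>
  of \<open>a\<close> of \<open>H $$ (i, r b) * cnj (H $$ (j, r b))\<close>, all other factors having modulus 1.  Summing over
  \<open>r\<close> factorizes into inner products of rows \<open>i\<close> and \<open>j\<close> of \<open>H\<close>, one for each neighbour, and
  connectedness supplies at least one neighbour.
\<close>

section \<open>Basis indices as label functions, and the partial trace as a sum over
  labellings\<close>

text \<open>Digits determine the index by \<open>label_inject\<close>, and both sides have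
  \<open>d ^ n\<close> elements, so injectivity already gives surjectivity. No explicit sum of
  digits is needed.\<close>

lemma bij_betw_labels:
  assumes "d > 0"
  shows "bij_betw (\<lambda>x. restrict (label d n x) {1..n}) {..<d ^ n} ({1..n} \<rightarrow>\<^sub>E {..<d})"
proof (rule bij_betw_imageI)
  show inj: "inj_on (\<lambda>x. restrict (label d n x) {1..n}) {..<d ^ n}"
  proof (rule inj_onI, rule label_inject)
    fix x y k
    assume eq: "restrict (label d n x) {1..n} = restrict (label d n y) {1..n}" and k: "k \<in> {1..n}"
    show "label d n x k = label d n y k"
      using fun_cong[OF eq, of k] k by simp
  qed auto
  show "(\<lambda>x. restrict (label d n x) {1..n}) ` {..<d ^ n} = {1..n} \<rightarrow>\<^sub>E {..<d}"
  proof (rule card_subset_eq)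
    show "(\<lambda>x. restrict (label d n x) {1..n}) ` {..<d ^ n} \<subseteq> {1..n} \<rightarrow>\<^sub>E {..<d}"
      using label_less[OF assms] by auto
    show "card ((\<lambda>x. restrict (label d n x) {1..n}) ` {..<d ^ n}) = card ({1..n} \<rightarrow>\<^sub>E {..<d})"
      unfolding card_image[OF inj] by (simp add: card_PiE)
  qed (simp add: finite_PiE)
qed

text \<open>The base-\<open>d\<close> number with prescribed digits, obtained as an inverse of the
  digit map. It is meaningful only for extensional functions on \<open>{1..n}\<close> with values
  below \<open>d\<close>.\<close>

definition index_of :: "nat \<Rightarrow> nat \<Rightarrow> (nat \<Rightarrow> nat) \<Rightarrow> nat" where
  "index_of d n = inv_into {..<d ^ n} (\<lambda>x. restrict (label d n x) {1..n})"

lemma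
  assumes "d > 0" "g \<in> {1..n} \<rightarrow>\<^sub>E {..<d}"
  shows index_of_less: "index_of d n g < d ^ n"
    and label_index_of: "k \<in> {1..n} \<Longrightarrow> label d n (index_of d n g) k = g k"
proof -
  let ?f = "\<lambda>x. restrict (label d n x) {1..n}"
  have g: "g \<in> ?f ` {..<d ^ n}"
    using bij_betw_labels[OF assms(1), of n] assms(2) by (simp add: bij_betw_def)
  show "index_of d n g < d ^ n"
    using inv_into_into[OF g] by (simp add: index_of_def)
  have "?f (index_of d n g) = g"
    using f_inv_into_f[OF g] by (simp add: index_of_def)
  from fun_cong[OF this, of k] show "label d n (index_of d n g) k = g k" if "k \<in> {1..n}"
    using that by simp
qed

text \<open>A pair of indices agreeing off \<open>a\<close> is the same as one labelling of the
  other qudits, since the labels at \<open>a\<close> are fixed to \<open>i\<close> and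
  \<open>j\<close>. A sum over a function space is what \<open>prod_sum_PiE\<close> later
  factorizes.\<close>

lemma partial_trace_except_index:
  assumes "a \<in> {1..n}" "i < d" "j < d"
  shows "partial_trace_except d n a R $$ (i, j) =
    (\<Sum>g\<in>({1..n} - {a}) \<rightarrow>\<^sub>E {..<d}. R $$ (index_of d n (g(a := i)), index_of d n (g(a := j))))"
proof -
  have d: "d > 0" using assms by simp
  have upd: "g(a := i) \<in> {1..n} \<rightarrow>\<^sub>E {..<d}"
    if "g \<in> ({1..n} - {a}) \<rightarrow>\<^sub>E {..<d}" "i < d" for g i
    using that assms(1) by (auto simp: PiE_iff extensional_def)
  let ?g = "\<lambda>x. restrict (label d n x) ({1..n} - {a})"
  have index: "index_of d n ((?g x)(a := label d n x a)) = x" if "x < d ^ n" for x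
  proof (rule label_inject[OF index_of_less[OF d] that])
    show *: "(?g x)(a := label d n x a) \<in> {1..n} \<rightarrow>\<^sub>E {..<d}"
      by (rule upd) (auto simp: label_less[OF d])
    show "label d n (index_of d n ((?g x)(a := label d n x a))) k = label d n x k"
      if "k \<in> {1..n}" for k
      unfolding label_index_of[OF d * that] using that by simp
  qed
  have eq_g: "?g x = ?g y" if "\<forall>k\<in>{1..n} - {a}. label d n x k = label d n y k" for x y
    using that by (auto simp: fun_eq_iff restrict_def)
  let ?P = "\<lambda>x y. x < d ^ n \<and> y < d ^ n \<and> label d n x a = i \<and> label d n y a = j \<and>
      (\<forall>k\<in>{1..n} - {a}. label d n x k = label d n y k)"
  have index_pair: "(index_of d n ((?g x)(a := i)), index_of d n ((?g x)(a := j))) = (x, y)"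
    if "?P x y" for x y
  proof -
    from that have xy: "x < d ^ n" "y < d ^ n" "label d n x a = i" "label d n y a = j"
      and "\<forall>k\<in>{1..n} - {a}. label d n x k = label d n y k" by blast+
    then have "?g x = ?g y" by (intro eq_g)
    with index[OF xy(1)] index[OF xy(2)] show ?thesis
      unfolding xy(3,4) by (simp only:)
  qed
  have "(\<Sum>(x, y) | x < d ^ n \<and> y < d ^ n \<and> label d n x a = i \<and> label d n y a = j \<and>
          (\<forall>k\<in>{1..n} - {a}. label d n x k = label d n y k). R $$ (x, y)) =
    (\<Sum>g\<in>({1..n} - {a}) \<rightarrow>\<^sub>E {..<d}. R $$ (index_of d n (g(a := i)), index_of d n (g(a := j))))"
  \<comment> \<open>The forward map forgets the label at \<open>a\<close>; the backward map inserts
    \<open>i\<close> and \<open>j\<close> there. The instantiated \<open>i\<close> and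
    \<open>j\<close> are the rule's own maps, while those inside the terms are the matrix
    indices.\<close>
  proof (rule sum.reindex_bij_witness[where j = "\<lambda>(x, y). ?g x" and
        i = "\<lambda>g. (index_of d n (g(a := i)), index_of d n (g(a := j)))"], goal_cases)
    case (1 p)
    obtain x y where p: "p = (x, y)" by (cases p)
    show ?case
      using index_pair[OF 1[unfolded p mem_Collect_eq prod.case]] unfolding p prod.case by (simp only:)
  next
    case (2 p)
    show ?case by (cases p) (simp add: label_less[OF d])
  next
    case (3 g)
    show ?case
    proof
      fix k
      show "(case (index_of d n (g(a := i)), index_of d n (g(a := j))) of (x, y) \<Rightarrow> ?g x) k = g k"
        \<comment> \<open>Outside \<open>{1..n} - {a}\<close>, in particular at \<open>a\<close>,
          both sides are \<open>undefined\<close>, so the inserted label leaves no trace.\<close>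
        using label_index_of[OF d upd[OF 3 assms(2)], of k] PiE_arb[OF 3, of k]
        by (cases "k \<in> {1..n} - {a}") auto
    qed
  next
    case (4 g)
    have "label d n (index_of d n (g(a := i))) k = label d n (index_of d n (g(a := j))) k"
      if "k \<in> {1..n} - {a}" for k
      using that label_index_of[OF d upd[OF 4 assms(2)], of k]
        label_index_of[OF d upd[OF 4 assms(3)], of k] by simp
    then show ?case
      using label_index_of[OF d upd[OF 4 assms(2)] assms(1)]
        label_index_of[OF d upd[OF 4 assms(3)] assms(1)]
        index_of_less[OF d upd[OF 4 assms(2)]] index_of_less[OF d upd[OF 4 assms(3)]]
      by simp
  next
    case (5 p)
    obtain x y where p: "p = (x, y)" by (cases p)
    show ?case
      using index_pair[OF 5[unfolded p mem_Collect_eq prod.case]] unfolding p prod.case by (simp only:)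
  qed
  then show ?thesis
    using assms by (simp add: partial_trace_except_def)
qed

section \<open>Amplitudes of the graph state\<close>

text \<open>Applying the operator to the basis vector 0 selects column 0. All labels of index 0 are
  0, so the tensor power contributes entries from column 0 of \<open>H\<close>, and the diagonal
  edge gates only multiply by their entry at \<open>x\<close>.\<close>

lemma graph_state_index:
  assumes "d > 0" "pair_graph G" "pverts G = {1..n}" "x < d ^ n"
  shows "graph_state d n G H $ x =
    complex_of_real (1 / real d powr (real n / 2)) *
      ((\<Prod>(u, v)\<in>edge_set G. H $$ (label d n x u, label d n x v)) *
       (\<Prod>k=1..n. H $$ (label d n x k, 0)))"
proof -
  let ?D = "\<lambda>x. \<Prod>(u, v)\<in>edge_set G. H $$ (label d n x u, label d n x v)"
  have pos: "0 < d ^ n" using assms(1) by simp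
  have T: "tensor_power d n H \<in> carrier_mat (d ^ n) (d ^ n)"
    by (simp add: tensor_power_def)
  have "graph_state d n G H $ x = graph_operator d n G H $$ (x, 0)"
    using assms(4) pos T
    by (simp add: graph_state_def graph_operator_def edge_gates_eq_diagonal[OF assms(1-3)])
  also have "\<dots> = complex_of_real (1 / real d powr (real n / 2)) *
      (\<Sum>k = 0..<d ^ n. (if x = k then ?D x else 0) * tensor_power d n H $$ (k, 0))"
    using assms(4) pos T
    by (simp add: graph_operator_def edge_gates_eq_diagonal[OF assms(1-3)] scalar_prod_def)
  also have "(\<Sum>k = 0..<d ^ n. (if x = k then ?D x else 0) * tensor_power d n H $$ (k, 0)) =
      (\<Sum>k = 0..<d ^ n. if x = k then ?D x * tensor_power d n H $$ (k, 0) else 0)"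
    by (intro sum.cong) auto
  also have "\<dots> = ?D x * tensor_power d n H $$ (x, 0)"
    using assms(4) by (simp add: sum.delta')
  also have "tensor_power d n H $$ (x, 0) = (\<Prod>k=1..n. H $$ (label d n x k, 0))"
    using assms(4) pos by (simp add: tensor_power_def label_def)
  finally show ?thesis .
qed

section \<open>Row orthogonality, edge phases and neighbours\<close>

lemma mult_cnj_eq_1: "cmod z = 1 \<Longrightarrow> z * cnj z = 1"
  using complex_norm_square[of z] by simp

text \<open>Entry \<open>(j, i)\<close> of \<open>mat_adjoint H * H\<close> is the inner product of
  columns; symmetry of \<open>H\<close> turns columns into rows.\<close>

lemma sum_row_mult_cnj:
  assumes "complex_hadamard d H" "transpose_mat H = H" "i < d" "j < d"
  shows "(\<Sum>r<d. H $$ (i, r) * cnj (H $$ (j, r))) = (if i = j then of_nat d else 0)"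
proof -
  have H: "H \<in> carrier_mat d d" and HH: "mat_adjoint H * H = of_nat d \<cdot>\<^sub>m 1\<^sub>m d"
    using assms(1) by (auto simp: complex_hadamard_def)
  have sym: "H $$ (s, r) = H $$ (r, s)" if "r < d" "s < d" for r s
    using arg_cong[OF assms(2), of "\<lambda>M. M $$ (r, s)"] H that by simp
  have "(mat_adjoint H * H) $$ (j, i) = (\<Sum>r = 0..<d. cnj (H $$ (r, j)) * H $$ (r, i))"
    using H assms(3,4)
    by (simp add: mat_adjoint_def scalar_prod_def mat_of_rows_def cols_def)
  also have "\<dots> = (\<Sum>r<d. H $$ (i, r) * cnj (H $$ (j, r)))"
    unfolding atLeast0LessThan by (rule sum.cong) (auto simp: sym assms mult.commute)
  finally show ?thesis
    using assms(3,4) by (auto simp: HH)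
qed

text \<open>
  Edges avoiding \<open>a\<close> contribute \<open>\<bar>h\<bar>\<^sup>2 = 1\<close>; symmetry of \<open>H\<close> makes the orientation of the remaining
  ones irrelevant.
\<close>

lemma prod_edges_mult_cnj:
  assumes H: "complex_hadamard d H" "transpose_mat H = H"
    and G: "pair_graph G" "pverts G = {1..n}" and a: "a \<in> {1..n}"
    and p: "\<And>k. k \<in> {1..n} \<Longrightarrow> p k < d" and q: "\<And>k. k \<in> {1..n} \<Longrightarrow> q k < d"
    and pq: "\<And>k. k \<in> {1..n} - {a} \<Longrightarrow> p k = q k"
  shows "(\<Prod>(u, v)\<in>edge_set G. H $$ (p u, p v)) * cnj (\<Prod>(u, v)\<in>edge_set G. H $$ (q u, q v)) =
    (\<Prod>k | (a, k) \<in> parcs G. H $$ (p a, p k) * cnj (H $$ (q a, p k)))"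
proof -
  interpret pair_graph G by fact
  have carrier: "H \<in> carrier_mat d d" and norm: "\<And>i j. i < d \<Longrightarrow> j < d \<Longrightarrow> cmod (H $$ (i, j)) = 1"
    using H(1) by (auto simp: complex_hadamard_def)
  have sym: "H $$ (s, r) = H $$ (r, s)" if "r < d" "s < d" for r s
    using arg_cong[OF H(2), of "\<lambda>M. M $$ (r, s)"] carrier that by simp
  have verts: "u \<in> {1..n}" "v \<in> {1..n}" "u \<noteq> v" "(v, u) \<in> parcs G" if "(u, v) \<in> parcs G" for u v
    using in_arcsD1[OF that] in_arcsD2[OF that] G(2) no_loops'[OF that] that arcs_symmetric by auto
  have fin: "finite (edge_set G)"
    by (rule finite_subset[OF _ finite_arcs]) (auto simp: edge_set_def)
  let ?F = "\<lambda>(u, v). H $$ (p u, p v) * cnj (H $$ (q u, q v))"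
  let ?N = "{k. (a, k) \<in> parcs G}"
  \<comment> \<open>The representative in \<open>edge_set G\<close> of the edge joining
    \<open>a\<close> and \<open>k\<close>, smaller endpoint first.\<close>
  let ?e = "\<lambda>k. (min a k, max a k)"
  have "(\<Prod>(u, v)\<in>edge_set G. H $$ (p u, p v)) * cnj (\<Prod>(u, v)\<in>edge_set G. H $$ (q u, q v)) =
      (\<Prod>e\<in>edge_set G. ?F e)"
    by (simp add: prod.distrib case_prod_beta)
  also have "\<dots> = (\<Prod>e\<in>?e ` ?N. ?F e)"
  proof (rule prod.mono_neutral_right[OF fin])
    show "?e ` ?N \<subseteq> edge_set G"
    proof
      fix e assume "e \<in> ?e ` ?N"
      then obtain k where k: "(a, k) \<in> parcs G" "e = ?e k" by blast
      show "e \<in> edge_set G"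
        using k verts(3,4)[OF k(1)] by (cases a k rule: linorder_cases) (auto simp: edge_set_def)
    qed
    show "\<forall>e\<in>edge_set G - ?e ` ?N. ?F e = 1"
    proof
      fix e assume e: "e \<in> edge_set G - ?e ` ?N"
      obtain u v where uv: "e = (u, v)" by (cases e)
      have arc: "(u, v) \<in> parcs G" "u < v" using e uv by (auto simp: edge_set_def)
      have "u \<noteq> a"
      proof
        assume "u = a"
        then have "e = ?e v" "v \<in> ?N" using arc uv by auto
        then show False using e by blast
      qed
      moreover have "v \<noteq> a"
      proof
        assume "v = a"
        then have "e = ?e u" "u \<in> ?N" using arc uv verts by auto
        then show False using e by blast
      qed
      ultimately show "?F e = 1"
        using verts[OF arc(1)] pq[of u] pq[of v] p[of u] p[of v] mult_cnj_eq_1[OF norm]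
        by (simp add: uv)
    qed
  qed
  \<comment> \<open>With \<open>a\<close> fixed, the unordered pair determines the other endpoint,
    so \<open>?e\<close> is injective.\<close>
  also have "\<dots> = (\<Prod>k\<in>?N. ?F (?e k))"
    by (rule prod.reindex_cong[OF _ refl refl])
      (auto simp: inj_on_def min_def max_def split: if_splits)
  also have "\<dots> = (\<Prod>k\<in>?N. H $$ (p a, p k) * cnj (H $$ (q a, p k)))"
  proof (rule prod.cong[OF refl])
    fix k assume "k \<in> ?N"
    then have k: "k \<in> {1..n}" "a \<noteq> k" using verts by auto
    then have "p k = q k" using pq by auto
    \<comment> \<open>If \<open>k < a\<close> the representative is \<open>(k, a)\<close>, and
      symmetry of \<open>H\<close> moves the label at \<open>a\<close> back to the first
      position.\<close>
    then show "?F (?e k) = H $$ (p a, p k) * cnj (H $$ (q a, p k))"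
      using p[OF k(1)] p[OF a] q[OF a] sym by (auto simp: min_def max_def)
  qed
  finally show ?thesis .
qed

text \<open>Arcs come in opposite pairs, so connectedness is strong connectedness; a path from
  \<open>a\<close> to a different vertex \<open>c\<close> must begin with an arc out of
  \<open>a\<close>.\<close>

lemma connected_imp_neighbour:
  assumes "Digraph_Component.connected (with_proj G)" "pair_graph G"
    and "a \<in> pverts G" "c \<in> pverts G" "a \<noteq> c"
  obtains b where "(a, b) \<in> parcs G"
proof -
  interpret pair_graph G by fact
  have "strongly_connected (with_proj G)"
    using symmetric_connected_imp_strongly_connected[OF sym_arcs assms(1)] .
  then have "a \<rightarrow>\<^sup>*\<^bsub>with_proj G\<^esub> c"
    using assms(3,4) by (auto simp: strongly_connected_def)
  then show thesis
    by (cases rule: converse_reachable_cases) (use assms(5) that in auto)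
qed

section \<open>The reduced density matrix at a vertex\<close>

theorem corollary6:
  fixes d n :: nat and H :: "complex mat" and G :: "nat pair_pre_digraph"
  assumes "d \<ge> 1"
    and "complex_hadamard d H"
    and "transpose_mat H = H"
    and "n \<ge> 2"
    and "pair_graph G"
    and "pverts G = {1..n}"
    and "Digraph_Component.connected (with_proj G)"
  shows "\<forall>a\<in>pverts G.
    partial_trace_except d n a (ket_bra (graph_state d n G H)) = (1 / of_nat d) \<cdot>\<^sub>m 1\<^sub>m d"
proof
  fix a assume "a \<in> pverts G"
  then have a: "a \<in> {1..n}" using assms(6) by simp
  have d: "d > 0" using assms(1) by simp
  interpret pair_graph G by fact
  have norm: "\<And>i j. i < d \<Longrightarrow> j < d \<Longrightarrow> cmod (H $$ (i, j)) = 1"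
    using assms(2) by (auto simp: complex_hadamard_def)
  define K where "K = {1..n} - {a}"
  define N where "N = {k. (a, k) \<in> parcs G}"
  define c where "c = complex_of_real (1 / real d powr (real n / 2))"
  have K: "finite K" "card K = n - 1" using a by (auto simp: K_def)
  have NK: "N \<subseteq> K"
    using in_arcsD2 no_loops' assms(6) by (auto simp: N_def K_def)
  have "\<exists>b\<in>{1..n}. b \<noteq> a"
    using assms(4) by (intro bexI[of _ "if a = 1 then 2 else 1"]) auto
  then obtain b where b: "b \<in> N"
    using connected_imp_neighbour[OF assms(7,5)] a assms(6) unfolding N_def by blast
  have cc: "c * cnj c = 1 / of_nat d ^ n"
  proof -
    have "(1 / real d powr (real n / 2)) * (1 / real d powr (real n / 2)) = 1 / real d ^ n"
      using d by (simp add: powr_add[symmetric] powr_realpow)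
    then have "c * cnj c = complex_of_real (1 / real d ^ n)"
      unfolding c_def complex_cnj_complex_of_real of_real_mult[symmetric] by (rule arg_cong)
    then show ?thesis by simp
  qed
  show "partial_trace_except d n a (ket_bra (graph_state d n G H)) = (1 / of_nat d) \<cdot>\<^sub>m 1\<^sub>m d"
  proof (rule eq_matI, goal_cases)
    case (1 i j)
    then have ij: "i < d" "j < d" by simp_all
    \<comment> \<open>Padding with 1 at non-neighbours lets the product run over all of
      \<open>K\<close>, matching the domain of the labellings \<open>g\<close>.\<close>
    let ?h = "\<lambda>k r. if k \<in> N then H $$ (i, r) * cnj (H $$ (j, r)) else 1"
    have entry: "ket_bra (graph_state d n G H) $$
          (index_of d n (g(a := i)), index_of d n (g(a := j))) =
        1 / of_nat d ^ n * (H $$ (i, 0) * cnj (H $$ (j, 0))) * (\<Prod>k\<in>K. ?h k (g k))"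
      if g: "g \<in> K \<rightarrow>\<^sub>E {..<d}" for g
    proof -
      have upd: "g(a := r) \<in> {1..n} \<rightarrow>\<^sub>E {..<d}" if "r < d" for r
        using g that a by (auto simp: K_def PiE_iff extensional_def)
      define x y where "x = index_of d n (g(a := i))" and "y = index_of d n (g(a := j))"
      note label_x = label_index_of[OF d upd[OF ij(1)], folded x_def]
      note label_y = label_index_of[OF d upd[OF ij(2)], folded y_def]
      have less: "x < d ^ n" "y < d ^ n"
        using index_of_less[OF d upd] ij by (auto simp: x_def y_def)
      have gK: "g k < d" if "k \<in> K" for k using g that by auto
      have "(\<Prod>k=1..n. H $$ (label d n x k, 0)) * cnj (\<Prod>k=1..n. H $$ (label d n y k, 0)) =
          (\<Prod>k\<in>{1..n}. H $$ (label d n x k, 0) * cnj (H $$ (label d n y k, 0)))"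
        by (simp add: prod.distrib)
      also have "\<dots> = H $$ (i, 0) * cnj (H $$ (j, 0)) *
          (\<Prod>k\<in>K. H $$ (label d n x k, 0) * cnj (H $$ (label d n y k, 0)))"
        using a by (simp add: prod.remove[of _ a] label_x label_y K_def)
      \<comment> \<open>Off \<open>a\<close> the labels of \<open>x\<close> and \<open>y\<close>
        coincide, so each factor is a squared modulus.\<close>
      also have "(\<Prod>k\<in>K. H $$ (label d n x k, 0) * cnj (H $$ (label d n y k, 0))) = 1"
        by (rule prod.neutral)
          (use d gK[unfolded K_def] in \<open>auto simp: label_x label_y K_def intro!: mult_cnj_eq_1 norm\<close>)
      finally have vertices: "(\<Prod>k=1..n. H $$ (label d n x k, 0)) *
          cnj (\<Prod>k=1..n. H $$ (label d n y k, 0)) = H $$ (i, 0) * cnj (H $$ (j, 0))" by simp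
      have "(\<Prod>(u, v)\<in>edge_set G. H $$ (label d n x u, label d n x v)) *
          cnj (\<Prod>(u, v)\<in>edge_set G. H $$ (label d n y u, label d n y v)) =
          (\<Prod>k\<in>N. H $$ (label d n x a, label d n x k) * cnj (H $$ (label d n y a, label d n x k)))"
        unfolding N_def
        by (rule prod_edges_mult_cnj[OF assms(2,3,5,6) a])
          (rule label_less[OF d], rule label_less[OF d], simp add: label_x label_y)
      also have "\<dots> = (\<Prod>k\<in>N. ?h k (g k))"
      proof (rule prod.cong[OF refl])
        fix k assume k: "k \<in> N"
        then have "k \<in> {1..n}" "k \<noteq> a" using NK by (auto simp: K_def)
        then show "H $$ (label d n x a, label d n x k) * cnj (H $$ (label d n y a, label d n x k)) =
            ?h k (g k)"
          using k by (simp add: label_x[OF a] label_y[OF a] label_x)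
      qed
      also have "\<dots> = (\<Prod>k\<in>K. ?h k (g k))"
        using K(1) NK by (intro prod.mono_neutral_left) auto
      finally have edges: "(\<Prod>(u, v)\<in>edge_set G. H $$ (label d n x u, label d n x v)) *
          cnj (\<Prod>(u, v)\<in>edge_set G. H $$ (label d n y u, label d n y v)) =
          (\<Prod>k\<in>K. ?h k (g k))" .
      have dim: "dim_vec (graph_state d n G H) = d ^ n"
        by (simp add: graph_state_def graph_operator_def edge_gates_eq_diagonal[OF d assms(5,6)])
      have "ket_bra (graph_state d n G H) $$ (x, y) =
          graph_state d n G H $ x * cnj (graph_state d n G H $ y)"
        using less by (simp add: ket_bra_def dim)
      also have "\<dots> = c * cnj c *
          ((\<Prod>k=1..n. H $$ (label d n x k, 0)) * cnj (\<Prod>k=1..n. H $$ (label d n y k, 0))) *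
          ((\<Prod>(u, v)\<in>edge_set G. H $$ (label d n x u, label d n x v)) *
            cnj (\<Prod>(u, v)\<in>edge_set G. H $$ (label d n y u, label d n y v)))"
        unfolding graph_state_index[OF d assms(5,6) less(1)]
          graph_state_index[OF d assms(5,6) less(2)] c_def[symmetric] complex_cnj_mult
        by (simp only: mult_ac)
      finally show ?thesis
        unfolding vertices edges cc unfolding x_def y_def .
    qed
    have "partial_trace_except d n a (ket_bra (graph_state d n G H)) $$ (i, j) =
        (\<Sum>g\<in>K \<rightarrow>\<^sub>E {..<d}.
          1 / of_nat d ^ n * (H $$ (i, 0) * cnj (H $$ (j, 0))) * (\<Prod>k\<in>K. ?h k (g k)))"
      unfolding partial_trace_except_index[OF a ij] K_def[symmetric]
      by (intro sum.cong refl entry)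
    also have "\<dots> = 1 / of_nat d ^ n * (H $$ (i, 0) * cnj (H $$ (j, 0))) *
        (\<Prod>k\<in>K. \<Sum>r<d. ?h k r)"
      using K(1) by (simp only: sum_distrib_left[symmetric] prod_sum_PiE finite_lessThan)
    \<comment> \<open>A neighbour contributes the inner product of rows \<open>i\<close> and
      \<open>j\<close>; any other qudit contributes a sum of \<open>d\<close> ones.\<close>
    also have "(\<Prod>k\<in>K. \<Sum>r<d. ?h k r) = (\<Prod>k\<in>K. if k \<in> N \<and> i \<noteq> j then 0 else of_nat d)"
    proof (rule prod.cong[OF refl])
      show "(\<Sum>r<d. ?h k r) = (if k \<in> N \<and> i \<noteq> j then 0 else of_nat d)" for k
        by (cases "k \<in> N") (simp_all add: sum_row_mult_cnj[OF assms(2,3) ij])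
    qed
    \<comment> \<open>For \<open>i \<noteq> j\<close> the neighbour \<open>b\<close> supplies a zero
      factor; for \<open>i = j\<close> each of the \<open>n - 1\<close> factors is
      \<open>d\<close>.\<close>
    also have "\<dots> = (if i = j then of_nat d ^ (n - 1) else 0)"
      using K b NK by (auto intro: prod_zero)
    \<comment> \<open>On the diagonal the prefactor from column 0 has value 1, and
      \<open>d ^ (n - 1) / d ^ n\<close> leaves \<open>1 / d\<close>.\<close>
    also have "1 / of_nat d ^ n * (H $$ (i, 0) * cnj (H $$ (j, 0))) * \<dots> =
        ((1 / of_nat d) \<cdot>\<^sub>m 1\<^sub>m d) $$ (i, j)"
      using ij d assms(4) mult_cnj_eq_1[OF norm[OF ij(1) d]]
      by (cases n) auto
    finally show ?case .
  qed (simp_all add: partial_trace_except_def)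
qed

end
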